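(* Let $s\ge1$ and $k\ge1$ be integers. Then $$\rho_{k,0}(2^s)=\sum_{i=0}^{\lfloor\frac{s-1}{2}\rfloor-1}\Big(2^{ki}2^{(s-2i-3)(k-1)}\cdot\rho^{(1)}_{k,2^{s-2i}}(8)\Big)+2^{\lfloor\frac{s-1}{2}\rfloor k}\cdot\rho^{(1)}_{k,0}\big(2^{s-2\lfloor\frac{s-1}{2}\rfloor}\big)+2^{\lfloor\frac{s}{2}\rfloor k},$$ where the sum is empty (equal to $0$) when its upper limit is $-1$.
   Context: For positive integers $k,n$ and an integer $\mu$, $\rho_{k,\mu}(n)$ is the number of $(x_1,\dots,x_k)\in(\mathbb{Z}/n\mathbb{Z})^k$ with $x_1^2+\cdots+x_k^2\equiv\mu\pmod n$. For integers $t\ge1$ and $\mu$, $\rho^{(1)}_{k,\mu}(2^t)$ is the number of $(x_1,\dots,x_k)\in(\mathbb{Z}/2^t\mathbb{Z})^k$ with $x_1^2+\cdots+x_k^2\equiv\mu\pmod{2^t}$ and $x_i$ odd for at least one $i$. *)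

theory Defs
  imports "HOL-Number_Theory.Cong" "HOL-Library.FuncSet"
begin

text \<open>
  A tuple in $(Z/nZ)^k$ is represented by the extensional function on the index set
  \<open>{1..k}\<close> whose values are the canonical representatives \<open>0, \<dots>, n - 1\<close>.
\<close>

definition residue_tuples :: "nat \<Rightarrow> nat \<Rightarrow> (nat \<Rightarrow> int) set" where
  "residue_tuples k n = {1..k} \<rightarrow>\<^sub>E {0..<int n}"

definition rho :: "nat \<Rightarrow> int \<Rightarrow> nat \<Rightarrow> nat" where
  "rho k \<mu> n =
    card {x \<in> residue_tuples k n. [(\<Sum>i=1..k. (x i)\<^sup>2) = \<mu>] (mod int n)}"

text \<open>
  Only meant for a modulus \<open>m = 2 ^ t\<close> with \<open>t \<ge> 1\<close>: as \<open>m\<close> is then even, the parity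
  of a residue class does not depend on the chosen representative.
\<close>

definition rho1 :: "nat \<Rightarrow> int \<Rightarrow> nat \<Rightarrow> nat" where
  "rho1 k \<mu> m =
    card {x \<in> residue_tuples k m.
      [(\<Sum>i=1..k. (x i)\<^sup>2) = \<mu>] (mod int m) \<and> (\<exists>i\<in>{1..k}. odd (x i))}"

end

theory Submission imports Defs begin

text \<open>
  A solution of \<open>x\<^sub>1\<^sup>2 + \<dots> + x\<^sub>k\<^sup>2 \<equiv> 0\<close> modulo \<open>2 ^ s\<close> either has an odd coordinate or is twice a
  tuple modulo \<open>2 ^ (s - 1)\<close> that solves the congruence modulo \<open>2 ^ (s - 2)\<close>. This gives a
  two-step recursion in \<open>s\<close>. For \<open>t \<ge> 3\<close>, adding \<open>2 ^ (t - 1)\<close> to an odd coordinate changes the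
  sum of squares by \<open>2 ^ t\<close> modulo \<open>2 ^ (t + 1)\<close>; hence exactly half of the lifts of the solutions
  modulo \<open>2 ^ t\<close> with an odd coordinate are solutions modulo \<open>2 ^ (t + 1)\<close>, and the counts with an
  odd coordinate reduce to the modulus 8.
\<close>

section \<open>Tuples of residues\<close>

lemma finite_residue_tuples [simp]: "finite (residue_tuples k n)"
  by (simp add: residue_tuples_def finite_PiE)

lemma card_residue_tuples: "card (residue_tuples k n) = n ^ k"
  by (simp add: residue_tuples_def card_PiE)

lemma restrict_residue_tuples: "x \<in> residue_tuples k n \<Longrightarrow> restrict x {1..k} = x"
  by (simp only: residue_tuples_def PiE_restrict)

lemma residue_tuples_bounds:
  assumes "x \<in> residue_tuples k n" "i \<in> {1..k}"
  shows "0 \<le> x i" "x i < int n"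
  using assms by (auto simp: residue_tuples_def PiE_iff)

lemma residue_tuples_update:
  assumes "x \<in> residue_tuples k n" "i \<in> {1..k}" "0 \<le> c" "c < int n"
  shows "x(i := c) \<in> residue_tuples k n"
  using assms by (auto simp: residue_tuples_def PiE_iff extensional_def)

lemma residue_tuples_eqI:
  assumes "x \<in> residue_tuples k n" "y \<in> residue_tuples k n" "\<And>i. i \<in> {1..k} \<Longrightarrow> x i = y i"
  shows "x = y"
  using assms unfolding residue_tuples_def by (rule PiE_ext)

section \<open>Lifting and halving tuples\<close>

text \<open>Division with remainder by \<open>m\<close> writes a residue modulo \<open>m * d\<close>
  uniquely as \<open>x + m * z\<close>, with \<open>x\<close> a residue modulo \<open>m\<close> and
  \<open>z\<close> one modulo \<open>d\<close>. Since \<open>P\<close> sees only \<open>x\<close>,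
  the \<open>d ^ k\<close> choices of \<open>z\<close> are free.\<close>

lemma card_residue_tuples_lift:
  fixes P :: "(nat \<Rightarrow> int) \<Rightarrow> bool"
  assumes "m > 0" and "d > 0"
    and P: "\<And>x y. (\<And>i. i \<in> {1..k} \<Longrightarrow> [x i = y i] (mod int m)) \<Longrightarrow> P x \<longleftrightarrow> P y"
  shows "card {x \<in> residue_tuples k (m * d). P x} = d ^ k * card {x \<in> residue_tuples k m. P x}"
proof -
  let ?A = "{x \<in> residue_tuples k m. P x} \<times> residue_tuples k d"
  let ?B = "{x \<in> residue_tuples k (m * d). P x}"
  let ?f = "\<lambda>(x, z). \<lambda>i\<in>{1..k}. x i + int m * z i :: int"
  let ?g = "\<lambda>w. (\<lambda>i\<in>{1..k}. w i mod int m, \<lambda>i\<in>{1..k}. w i div int m)"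
  have m: "int m > 0" using assms by simp
  have "bij_betw ?f ?A ?B"
  proof (rule bij_betw_byWitness[where f' = ?g])
    show "\<forall>a\<in>?A. ?g (?f a) = a"
    proof
      fix a assume "a \<in> ?A"
      then obtain x z where a: "a = (x, z)"
        and x: "x \<in> residue_tuples k m" and z: "z \<in> residue_tuples k d"
        by blast
      have "(\<lambda>i\<in>{1..k}. ?f (x, z) i mod int m) = restrict x {1..k}"
        using residue_tuples_bounds[OF x] by (intro restrict_ext) simp
      moreover have "(\<lambda>i\<in>{1..k}. ?f (x, z) i div int m) = restrict z {1..k}"
        using residue_tuples_bounds[OF x] m by (intro restrict_ext) simp
      ultimately show "?g (?f a) = a"
        by (simp only: a prod.case restrict_residue_tuples[OF x] restrict_residue_tuples[OF z])
    qed
    show "\<forall>w\<in>?B. ?f (?g w) = w"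
    proof
      fix w assume "w \<in> ?B"
      then have w: "w \<in> residue_tuples k (m * d)" by blast
      have "?f (?g w) = restrict w {1..k}"
        unfolding prod.case by (intro restrict_ext) simp
      then show "?f (?g w) = w" by (simp only: restrict_residue_tuples[OF w])
    qed
    show "?f ` ?A \<subseteq> ?B"
    proof (rule image_subsetI)
      fix a assume "a \<in> ?A"
      then obtain x z where a: "a = (x, z)"
        and x: "x \<in> residue_tuples k m" and Px: "P x" and z: "z \<in> residue_tuples k d"
        by blast
      have "0 \<le> x i + int m * z i \<and> x i + int m * z i < int (m * d)" if i: "i \<in> {1..k}" for i
      proof -
        have "z i \<le> int d - 1" using residue_tuples_bounds[OF z i] by simp
        then have "int m * z i \<le> int m * (int d - 1)" using m by (intro mult_left_mono) auto
        then show ?thesis using residue_tuples_bounds[OF x i] residue_tuples_bounds[OF z i] m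
          by (simp add: algebra_simps)
      qed
      then have "?f (x, z) \<in> residue_tuples k (m * d)"
        by (auto simp: residue_tuples_def)
      moreover have "P (?f (x, z))"
        using Px P[of "?f (x, z)" x] by (auto simp: cong_def)
      ultimately show "?f a \<in> ?B" unfolding a by blast
    qed
    show "?g ` ?B \<subseteq> ?A"
    proof (rule image_subsetI)
      fix w assume "w \<in> ?B"
      then have w: "w \<in> residue_tuples k (m * d)" and Pw: "P w" by auto
      have "0 \<le> w i div int m \<and> w i div int m < int d" if "i \<in> {1..k}" for i
      proof -
        have "int m * (w i div int m) \<le> w i"
          using m by (simp flip: minus_mod_eq_mult_div)
        also have "\<dots> < int m * int d" using residue_tuples_bounds[OF w that] by simp
        finally show ?thesis
          using residue_tuples_bounds[OF w that] m by (simp add: pos_imp_zdiv_nonneg_iff)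
      qed
      then have "(\<lambda>i\<in>{1..k}. w i div int m) \<in> residue_tuples k d"
        by (auto simp: residue_tuples_def)
      moreover have "(\<lambda>i\<in>{1..k}. w i mod int m) \<in> residue_tuples k m"
        using m by (auto simp: residue_tuples_def)
      moreover have "P (\<lambda>i\<in>{1..k}. w i mod int m)"
        using Pw P[of "\<lambda>i\<in>{1..k}. w i mod int m" w] by (auto simp: cong_def)
      ultimately show "?g w \<in> ?A" by blast
    qed
  qed
  then have "card ?B = card ?A" by (simp add: bij_betw_same_card)
  then show ?thesis by (simp add: card_cartesian_product card_residue_tuples)
qed

text \<open>Halving every coordinate is the bijection. The hypothesis makes \<open>P\<close> blind
  outside \<open>{1..k}\<close>, where \<open>\<lambda>i. 2 * y i\<close> need not agree with an
  extensional tuple.\<close>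

lemma card_even_residue_tuples:
  fixes P :: "(nat \<Rightarrow> int) \<Rightarrow> bool"
  assumes P: "\<And>x y. (\<And>i. i \<in> {1..k} \<Longrightarrow> x i = y i) \<Longrightarrow> P x \<longleftrightarrow> P y"
  shows "card {x \<in> residue_tuples k (2 * m). P x \<and> (\<forall>i\<in>{1..k}. even (x i))} =
    card {y \<in> residue_tuples k m. P (\<lambda>i. 2 * y i)}"
proof -
  let ?B = "{x \<in> residue_tuples k (2 * m). P x \<and> (\<forall>i\<in>{1..k}. even (x i))}"
  let ?A = "{y \<in> residue_tuples k m. P (\<lambda>i. 2 * y i)}"
  let ?f = "\<lambda>y. \<lambda>i\<in>{1..k}. 2 * y i :: int"
  let ?g = "\<lambda>x. \<lambda>i\<in>{1..k}. x i div 2 :: int"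
  have "bij_betw ?f ?A ?B"
  proof (rule bij_betw_byWitness[where f' = ?g])
    show "\<forall>y\<in>?A. ?g (?f y) = y"
    proof
      fix y assume "y \<in> ?A"
      then have y: "y \<in> residue_tuples k m" by blast
      have "?g (?f y) = restrict y {1..k}" by (intro restrict_ext) simp
      then show "?g (?f y) = y" by (simp only: restrict_residue_tuples[OF y])
    qed
    show "\<forall>x\<in>?B. ?f (?g x) = x"
    proof
      fix x assume "x \<in> ?B"
      then have x: "x \<in> residue_tuples k (2 * m)" and "\<forall>i\<in>{1..k}. even (x i)" by blast+
      then have "?f (?g x) = restrict x {1..k}" by (intro restrict_ext) simp
      then show "?f (?g x) = x" by (simp only: restrict_residue_tuples[OF x])
    qed
    show "?f ` ?A \<subseteq> ?B"
    proof safe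
      fix y assume "P (\<lambda>i. 2 * y i)"
      then show "P (?f y)" using P[of "?f y" "\<lambda>i. 2 * y i"] by simp
    qed (auto simp: residue_tuples_def PiE_iff)
    show "?g ` ?B \<subseteq> ?A"
    proof safe
      fix x assume "P x" and "\<forall>i\<in>{1..k}. even (x i)"
      then show "P (\<lambda>i. 2 * ?g x i)" using P[of "\<lambda>i. 2 * ?g x i" x] by simp
    qed (auto simp: residue_tuples_def PiE_iff)
  qed
  then show ?thesis by (simp add: bij_betw_same_card)
qed

section \<open>Solutions with an odd coordinate\<close>

definition odd_solutions :: "nat \<Rightarrow> int \<Rightarrow> nat \<Rightarrow> (nat \<Rightarrow> int) set" where
  "odd_solutions k \<mu> m = {x \<in> residue_tuples k m.
     [(\<Sum>i=1..k. (x i)\<^sup>2) = \<mu>] (mod int m) \<and> (\<exists>i\<in>{1..k}. odd (x i))}"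

lemma rho1_eq_card_odd_solutions: "rho1 k \<mu> m = card (odd_solutions k \<mu> m)"
  by (simp only: rho1_def odd_solutions_def)

lemma finite_odd_solutions: "finite (odd_solutions k \<mu> m)"
  by (simp add: odd_solutions_def)

lemma odd_solutionsI:
  assumes "x \<in> residue_tuples k m" "[(\<Sum>i=1..k. (x i)\<^sup>2) = \<mu>] (mod int m)"
    "i \<in> {1..k}" "odd (x i)"
  shows "x \<in> odd_solutions k \<mu> m"
  using assms unfolding odd_solutions_def by blast

lemma odd_solutionsD:
  assumes "x \<in> odd_solutions k \<mu> m"
  shows "x \<in> residue_tuples k m" "[(\<Sum>i=1..k. (x i)\<^sup>2) = \<mu>] (mod int m)"
    "\<exists>i\<in>{1..k}. odd (x i)"
  using assms unfolding odd_solutions_def by blast+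

section \<open>The two-step recursion\<close>

lemma rho_eq_rho1_plus_even:
  "rho k \<mu> m = rho1 k \<mu> m + card {x \<in> residue_tuples k m.
     [(\<Sum>i=1..k. (x i)\<^sup>2) = \<mu>] (mod int m) \<and> (\<forall>i\<in>{1..k}. even (x i))}"
  unfolding rho_def rho1_def
  by (subst card_Un_disjoint[symmetric]) (auto intro!: arg_cong[where f = card])

lemma rho1_cong: "[\<mu> = \<nu>] (mod int m) \<Longrightarrow> rho1 k \<mu> m = rho1 k \<nu> m"
  unfolding rho1_def cong_def by (simp only:)

text \<open>The summand 1 is the zero tuple, the only one modulo 2 without an odd
  coordinate.\<close>

lemma rho_two: "rho k 0 2 = rho1 k 0 2 + 1"
proof -
  have "card {x \<in> residue_tuples k (2 * 1).
      [(\<Sum>i=1..k. (x i)\<^sup>2) = 0] (mod 2) \<and> (\<forall>i\<in>{1..k}. even (x i))} =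
    card {y \<in> residue_tuples k 1. [(\<Sum>i=1..k. (2 * y i)\<^sup>2) = 0] (mod 2)}"
    by (rule card_even_residue_tuples) simp
  also have "{y \<in> residue_tuples k 1. [(\<Sum>i=1..k. (2 * y i)\<^sup>2) = 0] (mod 2)} = residue_tuples k 1"
    by (auto simp: cong_0_iff power_mult_distrib intro!: dvd_sum)
  finally show ?thesis
    using rho_eq_rho1_plus_even[of k 0 2]
    by (simp only: card_residue_tuples power_one mult_1_right of_nat_numeral)
qed

text \<open>For an even solution \<open>2 * y\<close> the factor 4 lowers the condition on
  \<open>y\<close> to modulus \<open>2 ^ r\<close>, while \<open>y\<close> itself ranges modulo
  \<open>2 ^ (r + 1)\<close>. Each of the \<open>k\<close> coordinates thus has two lifts, whence
  \<open>2 ^ k\<close>.\<close>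

lemma rho_power_two_step: "rho k 0 (2 ^ (r + 2)) = rho1 k 0 (2 ^ (r + 2)) + 2 ^ k * rho k 0 (2 ^ r)"
proof -
  let ?Q = "\<lambda>y :: nat \<Rightarrow> int. [(\<Sum>i=1..k. (y i)\<^sup>2) = 0] (mod int (2 ^ r))"
  have "card {x \<in> residue_tuples k (2 * 2 ^ (r + 1)).
      [(\<Sum>i=1..k. (x i)\<^sup>2) = 0] (mod int (2 ^ (r + 2))) \<and> (\<forall>i\<in>{1..k}. even (x i))} =
    card {y \<in> residue_tuples k (2 ^ (r + 1)).
      [(\<Sum>i=1..k. (2 * y i)\<^sup>2) = 0] (mod int (2 ^ (r + 2)))}"
    by (rule card_even_residue_tuples) simp
  also have "\<dots> = card {y \<in> residue_tuples k (2 ^ r * 2). ?Q y}"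
  proof -
    have "[(\<Sum>i=1..k. (2 * y i)\<^sup>2) = 0] (mod int (2 ^ (r + 2))) \<longleftrightarrow> ?Q y" for y
    proof -
      have "(\<Sum>i=1..k. (2 * y i)\<^sup>2) = 4 * (\<Sum>i=1..k. (y i)\<^sup>2)"
        by (simp add: power_mult_distrib sum_distrib_left)
      moreover have "int (2 ^ (r + 2)) = 4 * int (2 ^ r)" by simp
      ultimately show ?thesis
        by (simp only: cong_0_iff dvd_mult_cancel_left) simp
    qed
    then show ?thesis by (simp add: mult.commute)
  qed
  also have "\<dots> = 2 ^ k * card {y \<in> residue_tuples k (2 ^ r). ?Q y}"
  proof (rule card_residue_tuples_lift)
    fix x y :: "nat \<Rightarrow> int"
    assume "\<And>i. i \<in> {1..k} \<Longrightarrow> [x i = y i] (mod int (2 ^ r))"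
    then have "[(\<Sum>i=1..k. (x i)\<^sup>2) = (\<Sum>i=1..k. (y i)\<^sup>2)] (mod int (2 ^ r))"
      by (intro cong_sum cong_pow) auto
    then show "?Q x \<longleftrightarrow> ?Q y" by (simp add: cong_def)
  qed auto
  finally show ?thesis
    using rho_eq_rho1_plus_even[of k 0 "2 ^ (r + 2)"]
    by (simp only: rho_def[of k 0 "2 ^ r"] power_add power_one_right power2_eq_square ac_simps)
qed

section \<open>Reduction of the odd counts to modulus 8\<close>

text \<open>Adding \<open>2 ^ (t - 1)\<close> to the first odd coordinate maps the solutions for
  \<open>\<mu>\<close> injectively to those for \<open>\<mu> + 2 ^ t\<close>.\<close>

lemma rho1_add_half_modulus_le:
  assumes t: "t \<ge> 3"
  shows "rho1 k \<mu> (2 ^ (t + 1)) \<le> rho1 k (\<mu> + 2 ^ t) (2 ^ (t + 1))"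
proof -
  let ?M = "2 ^ (t + 1) :: int"
  let ?S = "\<lambda>\<mu>. odd_solutions k \<mu> (2 ^ (t + 1))"
  \<comment> \<open>The least odd index depends only on parities. As \<open>f\<close> preserves
    these, the changed position can be recovered from \<open>f x\<close>, which gives
    injectivity.\<close>
  define j where "j x = (LEAST i. i \<in> {1..k} \<and> odd (x i))" for x :: "nat \<Rightarrow> int"
  define f where "f x = x(j x := (x (j x) + 2 ^ (t - 1)) mod ?M)" for x
  have j: "j x \<in> {1..k}" "odd (x (j x))" if "\<exists>i\<in>{1..k}. odd (x i)" for x
  proof -
    have "j x \<in> {1..k} \<and> odd (x (j x))"
      unfolding j_def by (rule LeastI_ex) (use that in blast)
    then show "j x \<in> {1..k}" "odd (x (j x))" by auto
  qed
  have "even ((2 :: int) ^ (t - 1))" using t by simp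
  then have parity: "odd (f x i) \<longleftrightarrow> odd (x i)" for x i
    by (simp add: f_def dvd_mod_iff)
  have j_f: "j (f x) = j x" for x
    by (simp add: j_def parity)
  have "inj_on f (?S \<mu>)"
  proof (rule inj_onI)
    fix x y assume x: "x \<in> ?S \<mu>" and y: "y \<in> ?S \<mu>" and eq: "f x = f y"
    have jxy: "j x = j y" using j_f eq by metis
    have "x i = y i" if i: "i \<in> {1..k}" for i
    proof (cases "i = j x")
      case True
      \<comment> \<open>Reduction modulo \<open>?M\<close> in \<open>f\<close> leaves only a
        congruence here; the bounds on residues turn it into equality.\<close>
      have "[x i + 2 ^ (t - 1) = y i + 2 ^ (t - 1)] (mod ?M)"
        using fun_cong[OF eq, of i] True jxy by (simp add: f_def cong_def)
      then have "[x i = y i] (mod ?M)" by (simp only: cong_add_rcancel)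
      then show ?thesis
        using residue_tuples_bounds[OF odd_solutionsD(1)[OF x] i]
          residue_tuples_bounds[OF odd_solutionsD(1)[OF y] i]
        by (intro cong_less_imp_eq_int[where m = ?M]) simp_all
    next
      case False
      then show ?thesis using fun_cong[OF eq, of i] jxy by (simp add: f_def)
    qed
    then show "x = y"
      by (rule residue_tuples_eqI[OF odd_solutionsD(1)[OF x] odd_solutionsD(1)[OF y]])
  qed
  moreover have "f ` ?S \<mu> \<subseteq> ?S (\<mu> + 2 ^ t)"
  proof (rule image_subsetI)
    fix x assume x: "x \<in> ?S \<mu>"
    let ?j = "j x"
    have jx: "?j \<in> {1..k}" "odd (x ?j)" using j[OF odd_solutionsD(3)[OF x]] by this+
    have "f x \<in> residue_tuples k (2 ^ (t + 1))"
      unfolding f_def by (rule residue_tuples_update[OF odd_solutionsD(1)[OF x] jx(1)]) simp_all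
    moreover have "odd (f x ?j)" using jx(2) unfolding parity .
    moreover have "[(\<Sum>i=1..k. (f x i)\<^sup>2) = \<mu> + 2 ^ t] (mod int (2 ^ (t + 1)))"
    proof -
      obtain u where u: "t = u + 3" using t by (metis le_iff_add add.commute)
      obtain c where c: "x ?j = 2 * c + 1" using jx by (auto elim: oddE)
      \<comment> \<open>The cross term is \<open>2 ^ t * (2 * c + 1)\<close>, and the square of the
        shift is \<open>2 ^ (2 * u + 4) = ?M * 2 ^ u\<close>; here \<open>t \<ge> 3\<close> is
        essential.\<close>
      have "(x ?j + 2 ^ (t - 1))\<^sup>2 = (x ?j)\<^sup>2 + 2 ^ t + ?M * (c + 2 ^ u)"
        by (simp add: u c power2_eq_square algebra_simps power_add)
      then have "[(x ?j + 2 ^ (t - 1))\<^sup>2 = (x ?j)\<^sup>2 + 2 ^ t] (mod ?M)"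
        by (simp add: cong_def)
      then have sq: "[(f x ?j)\<^sup>2 = (x ?j)\<^sup>2 + 2 ^ t] (mod ?M)"
        by (simp add: f_def cong_def power_mod)
      have "(\<Sum>i=1..k. (f x i)\<^sup>2) = (f x ?j)\<^sup>2 + (\<Sum>i\<in>{1..k} - {?j}. (f x i)\<^sup>2)"
        using jx(1) by (simp only: sum.remove[OF finite_atLeastAtMost])
      also have "(\<Sum>i\<in>{1..k} - {?j}. (f x i)\<^sup>2) = (\<Sum>i\<in>{1..k} - {?j}. (x i)\<^sup>2)"
        by (intro sum.cong) (auto simp: f_def)
      also have "[(f x ?j)\<^sup>2 + \<dots> = ((x ?j)\<^sup>2 + 2 ^ t) + (\<Sum>i\<in>{1..k} - {?j}. (x i)\<^sup>2)] (mod ?M)"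
        by (intro cong_add sq cong_refl)
      also have "((x ?j)\<^sup>2 + 2 ^ t) + (\<Sum>i\<in>{1..k} - {?j}. (x i)\<^sup>2) = (\<Sum>i=1..k. (x i)\<^sup>2) + 2 ^ t"
        using jx(1) by (simp only: sum.remove[OF finite_atLeastAtMost] ac_simps)
      also have "[(\<Sum>i=1..k. (x i)\<^sup>2) + 2 ^ t = \<mu> + 2 ^ t] (mod ?M)"
        using odd_solutionsD(2)[OF x] by (intro cong_add cong_refl) simp
      finally show ?thesis by simp
    qed
    ultimately show "f x \<in> ?S (\<mu> + 2 ^ t)" using jx(1) by (intro odd_solutionsI)
  qed
  ultimately show ?thesis
    unfolding rho1_eq_card_odd_solutions by (rule card_inj_on_le[OF _ _ finite_odd_solutions])
qed

text \<open>Two shifts by \<open>2 ^ t\<close> cancel modulo \<open>2 ^ (t + 1)\<close>, so the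
  inequality used twice bounds each count by the other.\<close>

lemma rho1_add_half_modulus:
  assumes "t \<ge> 3"
  shows "rho1 k (\<mu> + 2 ^ t) (2 ^ (t + 1)) = rho1 k \<mu> (2 ^ (t + 1))"
proof (rule antisym)
  have "rho1 k (\<mu> + 2 ^ t) (2 ^ (t + 1)) \<le> rho1 k (\<mu> + 2 ^ t + 2 ^ t) (2 ^ (t + 1))"
    by (rule rho1_add_half_modulus_le[OF assms])
  also have "\<dots> = rho1 k \<mu> (2 ^ (t + 1))"
    by (rule rho1_cong) (simp add: cong_def)
  finally show "rho1 k (\<mu> + 2 ^ t) (2 ^ (t + 1)) \<le> rho1 k \<mu> (2 ^ (t + 1))" .
qed (rule rho1_add_half_modulus_le[OF assms])

text \<open>The lifts of the odd solutions modulo \<open>2 ^ t\<close> are counted twice: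
  \<open>2 ^ k\<close> over each solution, and as two equally large classes, for
  \<open>\<mu>\<close> and \<open>\<mu> + 2 ^ t\<close> modulo \<open>2 ^ (t + 1)\<close>.\<close>

lemma rho1_power_two_Suc:
  assumes t: "t \<ge> 3" and k: "k \<ge> 1"
  shows "rho1 k \<mu> (2 ^ (t + 1)) = 2 ^ (k - 1) * rho1 k \<mu> (2 ^ t)"
proof -
  let ?P = "\<lambda>x :: nat \<Rightarrow> int.
    [(\<Sum>i=1..k. (x i)\<^sup>2) = \<mu>] (mod int (2 ^ t)) \<and> (\<exists>i\<in>{1..k}. odd (x i))"
  let ?S = "\<lambda>\<mu>. odd_solutions k \<mu> (2 ^ (t + 1))"
  have split: "[a = \<mu>] (mod int (2 ^ t)) \<longleftrightarrow>
      [a = \<mu>] (mod int (2 ^ (t + 1))) \<or> [a = \<mu> + 2 ^ t] (mod int (2 ^ (t + 1)))" for a :: int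
  proof
    assume "[a = \<mu>] (mod int (2 ^ t))"
    then obtain c where c: "a - \<mu> = 2 ^ t * c" by (auto simp: cong_iff_dvd_diff)
    \<comment> \<open>The parity of the quotient \<open>c\<close> decides which of the two classes
      contains \<open>a\<close>.\<close>
    show "[a = \<mu>] (mod int (2 ^ (t + 1))) \<or> [a = \<mu> + 2 ^ t] (mod int (2 ^ (t + 1)))"
    proof (cases "even c")
      case True
      then show ?thesis using c by (auto simp: cong_iff_dvd_diff)
    next
      case False
      then obtain b where "c = 2 * b + 1" by (auto elim: oddE)
      then have "a - (\<mu> + 2 ^ t) = int (2 ^ (t + 1)) * b" using c by (simp add: algebra_simps)
      then show ?thesis by (metis cong_iff_dvd_diff dvd_triv_left)
    qed
  next
    have dvd: "int (2 ^ t) dvd int (2 ^ (t + 1))" by simp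
    assume "[a = \<mu>] (mod int (2 ^ (t + 1))) \<or> [a = \<mu> + 2 ^ t] (mod int (2 ^ (t + 1)))"
    then have "[a = \<mu>] (mod int (2 ^ t)) \<or> [a = \<mu> + 2 ^ t] (mod int (2 ^ t))"
      using cong_dvd_modulus[OF _ dvd] by blast
    then show "[a = \<mu>] (mod int (2 ^ t))" by (auto simp: cong_def)
  qed
  have disjoint: "?S \<mu> \<inter> ?S (\<mu> + 2 ^ t) = {}"
  proof -
    have "\<not> [\<mu> = \<mu> + 2 ^ t] (mod int (2 ^ (t + 1)))"
      by (simp add: cong_iff_dvd_diff)
    then have "x \<notin> ?S (\<mu> + 2 ^ t)" if "x \<in> ?S \<mu>" for x
      using cong_trans[OF cong_sym[OF odd_solutionsD(2)[OF that]] odd_solutionsD(2)] by blast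
    then show ?thesis by blast
  qed
  have "{x \<in> residue_tuples k (2 ^ t * 2). ?P x} = ?S \<mu> \<union> ?S (\<mu> + 2 ^ t)"
    unfolding split odd_solutions_def by (simp only: power_add power_one_right) blast
  then have "card {x \<in> residue_tuples k (2 ^ t * 2). ?P x} = card (?S \<mu>) + card (?S (\<mu> + 2 ^ t))"
    using disjoint by (simp only: card_Un_disjoint finite_odd_solutions)
  also have "\<dots> = 2 * rho1 k \<mu> (2 ^ (t + 1))"
    using rho1_add_half_modulus[OF t, of k \<mu>] by (simp only: rho1_eq_card_odd_solutions mult_2)
  finally have halves: "card {x \<in> residue_tuples k (2 ^ t * 2). ?P x} = 2 * rho1 k \<mu> (2 ^ (t + 1))" .
  have "card {x \<in> residue_tuples k (2 ^ t * 2). ?P x} = 2 ^ k * card {x \<in> residue_tuples k (2 ^ t). ?P x}"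
  proof (rule card_residue_tuples_lift)
    fix x y :: "nat \<Rightarrow> int"
    assume xy: "\<And>i. i \<in> {1..k} \<Longrightarrow> [x i = y i] (mod int (2 ^ t))"
    then have "[(\<Sum>i=1..k. (x i)\<^sup>2) = (\<Sum>i=1..k. (y i)\<^sup>2)] (mod int (2 ^ t))"
      by (intro cong_sum cong_pow) auto
    \<comment> \<open>Parity is a property of the class modulo \<open>2 ^ t\<close> because this
      modulus is even.\<close>
    moreover have "odd (x i) \<longleftrightarrow> odd (y i)" if "i \<in> {1..k}" for i
    proof -
      have "2 dvd int (2 ^ t)" using t by simp
      then have "[x i = y i] (mod 2)" using xy[OF that] cong_dvd_modulus by blast
      then show ?thesis using cong_dvd_iff by blast
    qed
    ultimately show "?P x \<longleftrightarrow> ?P y" by (simp only: cong_def cong: bex_cong)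
  qed auto
  moreover have "2 ^ k = 2 * (2 :: nat) ^ (k - 1)" using k by (simp flip: power_Suc)
  ultimately have "2 * rho1 k \<mu> (2 ^ (t + 1)) = 2 * (2 ^ (k - 1) * rho1 k \<mu> (2 ^ t))"
    unfolding halves by (simp only: rho1_def mult.assoc)
  then show ?thesis by simp
qed

lemma rho1_power_two_eq_rho1_8:
  assumes "t \<ge> 3" "k \<ge> 1"
  shows "rho1 k \<mu> (2 ^ t) = 2 ^ ((t - 3) * (k - 1)) * rho1 k \<mu> 8"
  using assms(1)
proof (induction t rule: dec_induct)
  case base
  then show ?case by simp
next
  case (step n)
  have "Suc n - 3 = Suc (n - 3)" using step by (simp add: Suc_diff_le)
  then have "2 ^ ((Suc n - 3) * (k - 1)) = 2 ^ (k - 1) * (2 :: nat) ^ ((n - 3) * (k - 1))"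
    by (simp only: mult_Suc power_add)
  then show ?case using rho1_power_two_Suc[of n k \<mu>] assms(2) step
    by (simp only: Suc_eq_plus1 mult.assoc)
qed

section \<open>Unrolling the recursion\<close>

text \<open>Passing from \<open>s - 2\<close> to \<open>s\<close> raises both
  \<open>(s - 1) div 2\<close> and \<open>s div 2\<close> by one. The factor \<open>2 ^ k\<close> of
  the recursion shifts the old summands by one index, and the new odd count becomes the summand for
  \<open>i = 0\<close>.\<close>

theorem theorem4:
  fixes s k :: nat
  assumes "s \<ge> 1" and "k \<ge> 1"
  shows "rho k 0 (2 ^ s) =
    (\<Sum>i\<in>{0..<(s - 1) div 2}.
       2 ^ (k * i) * 2 ^ ((s - 2 * i - 3) * (k - 1)) * rho1 k (2 ^ (s - 2 * i)) 8)
    + 2 ^ (((s - 1) div 2) * k) * rho1 k 0 (2 ^ (s - 2 * ((s - 1) div 2)))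
    + 2 ^ ((s div 2) * k)"
  using assms(1)
proof (induction s rule: less_induct)
  case (less s)
  consider "s = 1" | "s = 2" | "s \<ge> 3" using less.prems by linarith
  then show ?case
  proof cases
    case 1
    then show ?thesis by (simp add: rho_two)
  next
    case 2
    \<comment> \<open>For \<open>s = 2\<close> the recursion ends at \<open>2 ^ 0\<close>, outside
      the range of the induction hypothesis, so modulus 1 is counted directly.\<close>
    have "rho k 0 1 = 1"
      using card_residue_tuples[of k 1] by (simp add: rho_def)
    then show ?thesis using 2 rho_power_two_step[of k 0] by (simp add: power2_eq_square)
  next
    case 3
    define r where "r = s - 2"
    have s: "s = r + 2" and r: "r \<ge> 1" using 3 by (auto simp: r_def)
    let ?m = "(r - 1) div 2"
    let ?g = "\<lambda>s i. 2 ^ (k * i) * 2 ^ ((s - 2 * i - 3) * (k - 1)) * rho1 k (2 ^ (s - 2 * i)) 8"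
    have m: "(s - 1) div 2 = Suc ?m" using s r by simp
    \<comment> \<open>The recursion yields the target 0 and the formula has \<open>2 ^ s\<close>;
      both agree modulo 8.\<close>
    have "(8 :: int) dvd 2 ^ s" using le_imp_power_dvd[OF 3, of "2 :: int"] by simp
    then have "rho1 k 0 8 = rho1 k (2 ^ s) 8"
      by (intro rho1_cong) (simp add: cong_def)
    then have "rho1 k 0 (2 ^ s) = ?g s 0"
      using rho1_power_two_eq_rho1_8[OF 3 assms(2), of 0] by simp
    \<comment> \<open>Index \<open>Suc i\<close> for \<open>s\<close> and index \<open>i\<close> for
      \<open>r\<close> give the same \<open>s - 2 * Suc i = r - 2 * i\<close>; only the power of
      \<open>2 ^ k\<close> differs.\<close>
    moreover have "?g s (Suc i) = 2 ^ k * ?g r i" for i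
      by (simp add: s power_add)
    ultimately have sum: "(\<Sum>i\<in>{0..<(s - 1) div 2}. ?g s i) =
        rho1 k 0 (2 ^ s) + 2 ^ k * (\<Sum>i\<in>{0..<?m}. ?g r i)"
      by (simp only: m sum.atLeast0_lessThan_Suc_shift sum_distrib_left o_def)
    have "rho k 0 (2 ^ s) = rho1 k 0 (2 ^ s) + 2 ^ k * rho k 0 (2 ^ r)"
      using rho_power_two_step s by simp
    moreover have "s - 2 * Suc ?m = r - 2 * ?m" "s div 2 = Suc (r div 2)" using s by auto
    moreover have "rho k 0 (2 ^ r) = (\<Sum>i\<in>{0..<?m}. ?g r i)
        + 2 ^ (?m * k) * rho1 k 0 (2 ^ (r - 2 * ?m)) + 2 ^ ((r div 2) * k)"
      by (rule less.IH) (use s r in simp_all)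
    ultimately show ?thesis
      by (simp only: sum) (simp only: m distrib_left mult_Suc power_add mult.assoc add.assoc)
  qed
qed

end
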